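(* Assume $\phi$ is lower semi-continuous on $X$. Let $\{\rho_k\}$ and $\{\sigma_k\}$ be sequences of positive numbers such that $\rho_k\to\infty$ and $\sigma_k\to0$ as $k\to\infty$. Let $x_k\in\arg\min_{x\in X}\phi_{\rho_k,\sigma_k}(x)$ for each $k$. Then any accumulation point $\bar x$ of the sequence $\{x_k\}$ is an optimal solution of $\min_{x\in X}\phi(x)$, i.e., $\bar x\in\arg\min_{x\in X}\phi(x)$.
   Context: Setting: $X\subseteq\mathbb{R}^n$ and $Y\subseteq\mathbb{R}^m$ are closed convex sets, $F,f:\mathbb{R}^n\times\mathbb{R}^m\to\mathbb{R}$, $\mathcal{S}(x):=\arg\min_{y'\in Y}f(x,y')$, and $\phi(x):=\max\{F(x,y): y\in\mathcal{S}(x)\}$. The pessimistic bilevel problem is $\min_{x\in X}\phi(x)$. Standing assumptions: (1) $F$ is continuously differentiable, $\nabla F$ is Lipschitz continuous on $X\times Y$, and for some $\mu>0$, for every fixed $x\in X$, $F(x,\cdot)$ is $\mu$-strongly concave on $Y$. (2) $f$ is continuously differentiable, $\nabla f$ is Lipschitz continuous on $X\times Y$, and for every fixed $x\in X$, $f(x,\cdot)$ is convex on $Y$; $\mathcal{S}(x)\neq\varnothing$ for all $x\in X$; and for any bounded set $B\subseteq X$ there is a bounded set $D$ such that $\mathcal{S}(x)\cap D\ne\varnothing$ for every $x\in B$. For $\rho,\sigma>0$ and $x\in X$, $$\psi_{\rho,\sigma}(x,y,z):=F(x,y)-\rho(f(x,y)-f(x,z))+\frac{\sigma}{2}\|z\|^2-\sigma\langle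 y,z\rangle,\qquad \phi_{\rho,\sigma}(x):=\min_{z\in Y}\max_{y\in Y}\psi_{\rho,\sigma}(x,y,z).$$ Lower semi-continuity of $\phi$ on $X$: for any sequence $\{x_k\}\subset X$ with $x_k\to\bar x\in X$, $\phi(\bar x)\le\liminf_{k\to\infty}\phi(x_k)$. *)

theory Defs
  imports "HOL-Analysis.Analysis"
begin

definition argmin_set :: "('a \<Rightarrow> real) \<Rightarrow> 'a set \<Rightarrow> 'a set" where
  "argmin_set g A = {a. is_arg_min g (\<lambda>b. b \<in> A) a}"

definition C1_lipschitz_gradient_on :: "'a::real_inner set \<Rightarrow> ('a \<Rightarrow> real) \<Rightarrow> bool" where
  "C1_lipschitz_gradient_on A g \<longleftrightarrow>
     (\<exists>G. (\<forall>p. GDERIV g p :> G p) \<and> continuous_on UNIV G \<and> (\<exists>L. L-lipschitz_on A G))"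

definition strongly_concave_on :: "real \<Rightarrow> 'a::real_normed_vector set \<Rightarrow> ('a \<Rightarrow> real) \<Rightarrow> bool" where
  "strongly_concave_on \<mu> A g \<longleftrightarrow>
     convex A \<and>
     (\<forall>u\<in>A. \<forall>v\<in>A. \<forall>t\<in>{0..1}.
        g ((1 - t) *\<^sub>R u + t *\<^sub>R v)
          \<ge> (1 - t) * g u + t * g v + \<mu> / 2 * t * (1 - t) * (norm (u - v))\<^sup>2)"

definition lsc_on :: "'a::topological_space set \<Rightarrow> ('a \<Rightarrow> real) \<Rightarrow> bool" where
  "lsc_on A g \<longleftrightarrow>
     (\<forall>x a. (\<forall>k. x k \<in> A) \<and> a \<in> A \<and> x \<longlonglongrightarrow> a \<longrightarrow>
        ereal (g a) \<le> liminf (\<lambda>k. ereal (g (x k))))"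

definition accumulation_point :: "(nat \<Rightarrow> 'a::topological_space) \<Rightarrow> 'a \<Rightarrow> bool" where
  "accumulation_point x a \<longleftrightarrow> (\<exists>r. strict_mono r \<and> (x \<circ> r) \<longlonglongrightarrow> a)"

definition lower_sol :: "('a \<times> 'b \<Rightarrow> real) \<Rightarrow> 'b set \<Rightarrow> 'a \<Rightarrow> 'b set" where
  "lower_sol f Y x = argmin_set (\<lambda>y. f (x, y)) Y"

text \<open>
  The maxima and minima below are genuine ones (\<open>Greatest\<close>/\<open>Least\<close> are only specified when
  attained).  For \<open>x \<in> X\<close> they are attained under the standing assumptions: by strong concavity
  in \<open>y\<close>, and, for the outer minimum, by strong convexity in \<open>z\<close> of the value of the inner maximum.
\<close>
definition pess_value ::
  "('a \<times> 'b \<Rightarrow> real) \<Rightarrow> ('a \<times> 'b \<Rightarrow> real) \<Rightarrow> 'b set \<Rightarrow> 'a \<Rightarrow> real" where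
  "pess_value F f Y x = (GREATEST v. v \<in> (\<lambda>y. F (x, y)) ` lower_sol f Y x)"

definition psi ::
  "('a \<times> 'b \<Rightarrow> real) \<Rightarrow> ('a \<times> 'b \<Rightarrow> real) \<Rightarrow> real \<Rightarrow> real \<Rightarrow> 'a \<Rightarrow> 'b::real_inner \<Rightarrow> 'b \<Rightarrow> real" where
  "psi F f \<rho> \<sigma> x y z =
     F (x, y) - \<rho> * (f (x, y) - f (x, z)) + \<sigma> / 2 * (norm z)\<^sup>2 - \<sigma> * (y \<bullet> z)"

definition phi_reg ::
  "('a \<times> 'b \<Rightarrow> real) \<Rightarrow> ('a \<times> 'b \<Rightarrow> real) \<Rightarrow> 'b::real_inner set \<Rightarrow> real \<Rightarrow> real \<Rightarrow> 'a \<Rightarrow> real" where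
  "phi_reg F f Y \<rho> \<sigma> x =
     (LEAST w. w \<in> (\<lambda>z. GREATEST v. v \<in> (\<lambda>y. psi F f \<rho> \<sigma> x y z) ` Y) ` Y)"

end

theory Submission
  imports Defs
begin

text \<open>
  Let \<open>y\<^sub>u\<close> maximise \<open>F (u, \<cdot>)\<close> over the lower-level solutions at \<open>u\<close>.  Playing \<open>y = y\<^sub>u\<close> against an
  arbitrary \<open>z\<close> and completing the square shows that the regularised value is at least
  \<open>\<phi> u - \<sigma> / 2 * \<parallel>y\<^sub>u\<parallel>\<^sup>2\<close>; playing \<open>z = y\<^sub>u\<close> shows that, for fixed \<open>u\<close>, its limes superior as
  \<open>\<rho> \<rightarrow> \<infinity>\<close> and \<open>\<sigma> \<rightarrow> 0\<close> is at most \<open>\<phi> u\<close>, since near-optimal responses \<open>y\<close> stay bounded and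
  accumulate at lower-level solutions.  Strong concavity keeps \<open>y\<^sub>u\<close> bounded while \<open>u\<close> runs through a
  convergent sequence, so the error in the lower bound vanishes along the minimisers, and lower
  semicontinuity yields \<open>\<phi> xbar \<le> \<phi> u\<close> for every \<open>u\<close>.
\<close>

section \<open>Attainment of extrema\<close>

text \<open>Sublevel sets are nested, so the finite intersection property yields a point common to
  all of them. Sublevel sets are the convenient hypothesis because those of \<open>inner_max\<close>
  are intersections of closed sets.\<close>

lemma attains_min_compact_sublevels:
  fixes g :: "'a::t2_space \<Rightarrow> 'b::linorder"
  assumes "A \<noteq> {}" and cpt: "\<And>b. b \<in> A \<Longrightarrow> compact {a \<in> A. g a \<le> g b}"
  obtains a where "a \<in> A" "\<And>b. b \<in> A \<Longrightarrow> g a \<le> g b"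
proof -
  let ?L = "\<lambda>b. {a \<in> A. g a \<le> g b}"
  obtain a0 where a0: "a0 \<in> A"
    using assms(1) by blast
  have "?L a0 \<inter> \<Inter> (?L ` A) \<noteq> {}"
  proof (rule compact_imp_fip)
    show "compact (?L a0)"
      using cpt a0 .
    show "closed T" if "T \<in> ?L ` A" for T
      using that cpt by (auto intro: compact_imp_closed)
    show "?L a0 \<inter> \<Inter> H \<noteq> {}" if H: "finite H" "H \<subseteq> ?L ` A" for H
    proof -
      obtain B where B: "B \<subseteq> A" "finite B" "H = ?L ` B"
        using finite_subset_image[OF H] by blast
      have "g ` insert a0 B \<noteq> {}" "finite (g ` insert a0 B)"
        using B by auto
      \<comment> \<open>The best of finitely many points lies in the sublevel set of each of
        them.\<close>
      then obtain b where b: "b \<in> insert a0 B" "g b = Min (g ` insert a0 B)"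
        using Min_in[of "g ` insert a0 B"] by force
      have "g b \<le> g c" if "c \<in> insert a0 B" for c
        unfolding b(2) using B(2) that by (intro Min_le) auto
      then have "b \<in> ?L a0 \<inter> \<Inter> H"
        using b(1) B a0 by auto
      then show ?thesis by blast
    qed
  qed
  then show ?thesis
    using that by blast
qed

lemma Greatest_image_eq:
  fixes g :: "'a \<Rightarrow> 'b::order"
  assumes "a \<in> A" "\<And>b. b \<in> A \<Longrightarrow> g b \<le> g a"
  shows "(GREATEST v. v \<in> g ` A) = g a"
  using assms by (intro Greatest_equality) auto

lemma Least_image_eq:
  fixes g :: "'a \<Rightarrow> 'b::order"
  assumes "a \<in> A" "\<And>b. b \<in> A \<Longrightarrow> g a \<le> g b"
  shows "(LEAST v. v \<in> g ` A) = g a"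
  using assms by (intro Least_equality) auto

lemma mem_argmin_set_iff:
  "a \<in> argmin_set g A \<longleftrightarrow> a \<in> A \<and> (\<forall>b\<in>A. g a \<le> g b)"
  by (auto simp: argmin_set_def is_arg_min_linorder)

lemma C1_lipschitz_gradient_on_imp_continuous:
  assumes "C1_lipschitz_gradient_on A g"
  shows "continuous_on UNIV g"
proof -
  obtain G where "\<And>p. GDERIV g p :> G p"
    using assms unfolding C1_lipschitz_gradient_on_def by blast
  then have "isCont g p" for p
    unfolding gderiv_def using has_derivative_continuous by blast
  then show ?thesis
    by (simp add: continuous_on_eq_continuous_at)
qed

section \<open>Strong concavity and bounded superlevel sets\<close>

text \<open>Lets \<open>psi\<close> inherit from \<open>F\<close> the modulus \<mu> itself, so that
  later bounds are uniform in \<rho> and \<sigma>.\<close>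

lemma strongly_concave_on_diff_convex:
  assumes "strongly_concave_on \<mu> A g" "convex_on A h"
  shows "strongly_concave_on \<mu> A (\<lambda>y. g y - h y)"
  unfolding strongly_concave_on_def
proof (intro conjI ballI)
  show "convex A"
    using assms(1) unfolding strongly_concave_on_def by blast
  fix u v and t :: real
  assume *: "u \<in> A" "v \<in> A" "t \<in> {0..1}"
  have "g ((1 - t) *\<^sub>R u + t *\<^sub>R v)
      \<ge> (1 - t) * g u + t * g v + \<mu> / 2 * t * (1 - t) * (norm (u - v))\<^sup>2"
    using assms(1) * unfolding strongly_concave_on_def by blast
  moreover have "h ((1 - t) *\<^sub>R u + t *\<^sub>R v) \<le> (1 - t) * h u + t * h v"
    using convex_onD[OF assms(2), of t u v] * by auto
  ultimately show "g ((1 - t) *\<^sub>R u + t *\<^sub>R v) - h ((1 - t) *\<^sub>R u + t *\<^sub>R v)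
      \<ge> (1 - t) * (g u - h u) + t * (g v - h v) + \<mu> / 2 * t * (1 - t) * (norm (u - v))\<^sup>2"
    by (simp add: algebra_simps)
qed

text \<open>
  The point at distance 1 from \<open>b\<close> on the segment from \<open>b\<close> to \<open>a\<close> carries a strong-concavity
  surplus that grows linearly with the distance of \<open>a\<close>.
\<close>
lemma strongly_concave_on_superlevel_bound:
  assumes sc: "strongly_concave_on \<mu> A g" and "\<mu> > 0"
    and A: "a \<in> A" "b \<in> A" and le: "g b \<le> g a"
    and M: "\<And>p. p \<in> A \<Longrightarrow> p \<in> cball b 1 \<Longrightarrow> g p \<le> M"
  shows "norm (a - b) \<le> 1 + 2 * (M - g b) / \<mu>"
proof (cases "norm (a - b) \<le> 1")
  case True
  then show ?thesis
    using M[of b] A \<open>\<mu> > 0\<close> by (simp add: add_increasing2)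
next
  case False
  define R where "R = norm (b - a)"
  define t where "t = 1 / R"
  define p where "p = (1 - t) *\<^sub>R b + t *\<^sub>R a"
  have R: "R > 1"
    using False by (simp add: R_def norm_minus_commute)
  then have t: "t \<in> {0..1}" "t * R = 1"
    by (auto simp: t_def)
  have "p \<in> A"
    using sc A t unfolding strongly_concave_on_def p_def convex_alt by auto
  moreover have "b - p = t *\<^sub>R (b - a)"
    by (simp add: p_def algebra_simps)
  then have "dist b p = 1"
    using t by (simp add: dist_norm R_def)
  ultimately have "g p \<le> M"
    by (intro M) auto
  have "g p \<ge> (1 - t) * g b + t * g a + \<mu> / 2 * t * (1 - t) * R\<^sup>2"
    using sc A t(1) unfolding strongly_concave_on_def p_def R_def by blast
  \<comment> \<open>With \<open>t * R = 1\<close> the surplus becomes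
    \<open>\<mu> / 2 * (R - 1)\<close>, linear in the distance \<open>R\<close>.\<close>
  moreover have "\<mu> / 2 * t * (1 - t) * R\<^sup>2 = \<mu> / 2 * ((t * R) * (R - t * R))"
    by (simp add: power2_eq_square field_simps)
  then have "\<mu> / 2 * t * (1 - t) * R\<^sup>2 = \<mu> / 2 * (R - 1)"
    using t(2) by simp
  moreover have "t * g b \<le> t * g a"
    using t le by (intro mult_left_mono) auto
  ultimately have "g b + \<mu> / 2 * (R - 1) \<le> M"
    using \<open>g p \<le> M\<close> unfolding left_diff_distrib by linarith
  then show ?thesis
    using \<open>\<mu> > 0\<close> by (simp add: R_def norm_minus_commute field_simps)
qed

lemma strongly_concave_on_superlevel_bounded:
  fixes g :: "'a::euclidean_space \<Rightarrow> real"
  assumes "strongly_concave_on \<mu> A g" "\<mu> > 0" "closed A" "continuous_on A g" "b \<in> A"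
  shows "bounded {a \<in> A. g b \<le> g a}"
proof -
  have "compact (A \<inter> cball b 1)"
    using assms(3) by (simp add: closed_Int_compact)
  then have "compact (g ` (A \<inter> cball b 1))"
    by (intro compact_continuous_image continuous_on_subset[OF assms(4)]) auto
  then have "bdd_above (g ` (A \<inter> cball b 1))"
    by (intro bounded_imp_bdd_above compact_imp_bounded)
  then obtain M where "\<And>p. p \<in> A \<inter> cball b 1 \<Longrightarrow> g p \<le> M"
    unfolding bdd_above_def by blast
  then have "norm (a - b) \<le> 1 + 2 * (M - g b) / \<mu>" if "a \<in> A" "g b \<le> g a" for a
    by (intro strongly_concave_on_superlevel_bound[OF assms(1,2) that(1) assms(5) that(2)]) auto
  then have "{a \<in> A. g b \<le> g a} \<subseteq> cball b (1 + 2 * (M - g b) / \<mu>)"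
    by (auto simp: dist_norm norm_minus_commute[of b])
  then show ?thesis
    using bounded_cball bounded_subset by blast
qed

text \<open>Separating \<open>S\<close> from \<open>A\<close> covers both \<open>Y\<close> and
  \<open>lower_sol f Y u\<close>: superlevel sets within \<open>S\<close> inherit boundedness from
  those within \<open>A\<close>.\<close>

lemma strongly_concave_on_attains_max:
  fixes g :: "'a::euclidean_space \<Rightarrow> real"
  assumes "strongly_concave_on \<mu> A g" "\<mu> > 0" "closed A" "continuous_on A g"
    and "closed S" "S \<subseteq> A" "S \<noteq> {}"
  obtains a where "a \<in> S" "\<And>b. b \<in> S \<Longrightarrow> g b \<le> g a"
proof -
  have "compact {a \<in> S. - g a \<le> - g b}" if "b \<in> S" for b
  proof -
    have "bounded {a \<in> S. g b \<le> g a}"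
      using that assms(6)
      by (intro bounded_subset[OF strongly_concave_on_superlevel_bounded[OF assms(1-4), of b]]) auto
    moreover have "closed {a \<in> S. g b \<le> g a}"
      using assms(4-6) continuous_on_subset
      by (intro continuous_on_closed_Collect_le) (auto intro: continuous_intros)
    ultimately show ?thesis
      by (simp add: compact_eq_bounded_closed)
  qed
  from attains_min_compact_sublevels[OF assms(7) this] that show ?thesis
    by (metis neg_le_iff_le)
qed

section \<open>Lower-level solutions and the pessimistic value\<close>

locale lower_level =
  fixes X :: "'a::euclidean_space set" and Y :: "'b::euclidean_space set"
    and F f :: "'a \<times> 'b \<Rightarrow> real" and \<mu> :: real
  assumes closed_Y: "closed Y"
    and continuous_F: "continuous_on UNIV F" and continuous_f: "continuous_on UNIV f"
    and \<mu>_pos: "\<mu> > 0"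
    and strongly_concave_F: "\<And>u. u \<in> X \<Longrightarrow> strongly_concave_on \<mu> Y (\<lambda>y. F (u, y))"
    and convex_f: "\<And>u. u \<in> X \<Longrightarrow> convex_on Y (\<lambda>y. f (u, y))"
    and lower_sol_nonempty: "\<And>u. u \<in> X \<Longrightarrow> lower_sol f Y u \<noteq> {}"
begin

lemma continuous_on_F [continuous_intros]:
  "continuous_on A h \<Longrightarrow> continuous_on A k \<Longrightarrow> continuous_on A (\<lambda>y. F (h y, k y))"
  using continuous_on_compose2[OF continuous_F, of A "\<lambda>y. (h y, k y)"]
  by (simp add: continuous_on_Pair)

lemma continuous_on_f [continuous_intros]:
  "continuous_on A h \<Longrightarrow> continuous_on A k \<Longrightarrow> continuous_on A (\<lambda>y. f (h y, k y))"
  using continuous_on_compose2[OF continuous_f, of A "\<lambda>y. (h y, k y)"]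
  by (simp add: continuous_on_Pair)

lemma mem_lower_sol_iff:
  "y \<in> lower_sol f Y u \<longleftrightarrow> y \<in> Y \<and> (\<forall>y'\<in>Y. f (u, y) \<le> f (u, y'))"
  by (simp add: lower_sol_def mem_argmin_set_iff)

lemma closed_lower_sol: "closed (lower_sol f Y u)"
proof -
  have "lower_sol f Y u = Y \<inter> (\<Inter>y'\<in>Y. {y. f (u, y) \<le> f (u, y')})"
    by (auto simp: mem_lower_sol_iff)
  then show ?thesis
    using closed_Y by (auto intro!: closed_Int closed_INT closed_Collect_le continuous_intros)
qed

lemma pess_value_attained:
  assumes "u \<in> X"
  obtains y where "y \<in> lower_sol f Y u" "pess_value F f Y u = F (u, y)"
    "\<And>y'. y' \<in> lower_sol f Y u \<Longrightarrow> F (u, y') \<le> F (u, y)"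
proof -
  have "continuous_on Y (\<lambda>y. F (u, y))" "lower_sol f Y u \<subseteq> Y"
    by (auto intro!: continuous_intros simp: mem_lower_sol_iff)
  from strongly_concave_on_attains_max[OF strongly_concave_F[OF assms] \<mu>_pos closed_Y
      this(1) closed_lower_sol this(2) lower_sol_nonempty[OF assms]]
  obtain y where y: "y \<in> lower_sol f Y u"
    "\<And>y'. y' \<in> lower_sol f Y u \<Longrightarrow> F (u, y') \<le> F (u, y)"
    by blast
  show ?thesis
    using that[OF y(1)] Greatest_image_eq[where g = "\<lambda>y. F (u, y)", OF y] y(2) unfolding pess_value_def by blast
qed

text \<open>As a function of \<open>y\<close>, \<open>psi\<close> is \<open>F\<close> minus the sum
  of the convex term \<open>\<rho> * f (u, y)\<close> and an affine term.\<close>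

lemma strongly_concave_psi:
  assumes "u \<in> X" "\<rho> > 0"
  shows "strongly_concave_on \<mu> Y (\<lambda>y. psi F f \<rho> \<sigma> u y z)"
proof -
  have "convex Y"
    using strongly_concave_F[OF assms(1)] unfolding strongly_concave_on_def by blast
  then have "convex_on Y (\<lambda>y. \<sigma> * (y \<bullet> z) - (\<rho> * f (u, z) + \<sigma> / 2 * (norm z)\<^sup>2))"
    by (intro convex_onI) (auto simp: inner_add_left inner_diff_left field_simps)
  then have "convex_on Y
      (\<lambda>y. \<rho> * f (u, y) + (\<sigma> * (y \<bullet> z) - (\<rho> * f (u, z) + \<sigma> / 2 * (norm z)\<^sup>2)))"
    using assms convex_f by (intro convex_on_add convex_on_cmul) auto
  from strongly_concave_on_diff_convex[OF strongly_concave_F[OF assms(1)] this] show ?thesis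
    by (simp add: psi_def algebra_simps)
qed

section \<open>The regularised value\<close>

definition inner_max :: "real \<Rightarrow> real \<Rightarrow> 'a \<Rightarrow> 'b \<Rightarrow> real" where
  "inner_max \<rho> \<sigma> u z = (GREATEST v. v \<in> (\<lambda>y. psi F f \<rho> \<sigma> u y z) ` Y)"

lemma inner_max_attained:
  assumes "u \<in> X" "\<rho> > 0"
  obtains y where "y \<in> Y" "inner_max \<rho> \<sigma> u z = psi F f \<rho> \<sigma> u y z"
    "\<And>y'. y' \<in> Y \<Longrightarrow> psi F f \<rho> \<sigma> u y' z \<le> psi F f \<rho> \<sigma> u y z"
proof -
  have "continuous_on Y (\<lambda>y. psi F f \<rho> \<sigma> u y z)"
    unfolding psi_def by (intro continuous_intros)
  moreover have "Y \<noteq> {}"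
    using lower_sol_nonempty[OF assms(1)] mem_lower_sol_iff by blast
  ultimately obtain y where y: "y \<in> Y"
    "\<And>y'. y' \<in> Y \<Longrightarrow> psi F f \<rho> \<sigma> u y' z \<le> psi F f \<rho> \<sigma> u y z"
    using strongly_concave_on_attains_max[OF strongly_concave_psi[OF assms] \<mu>_pos closed_Y
        _ closed_Y subset_refl] by blast
  then show ?thesis
    using that[OF y(1)] Greatest_image_eq[of y Y "\<lambda>y. psi F f \<rho> \<sigma> u y z", OF y]
    unfolding inner_max_def by blast
qed

text \<open>Attainment turns upper bounds on the maximum into pointwise bounds; each sublevel set in
  \<open>z\<close> thus becomes an intersection over \<open>y\<close>.\<close>

lemma inner_max_le_iff:
  assumes "u \<in> X" "\<rho> > 0"
  shows "inner_max \<rho> \<sigma> u z \<le> c \<longleftrightarrow> (\<forall>y\<in>Y. psi F f \<rho> \<sigma> u y z \<le> c)"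
proof -
  obtain y where y: "y \<in> Y" "inner_max \<rho> \<sigma> u z = psi F f \<rho> \<sigma> u y z"
    "\<And>y'. y' \<in> Y \<Longrightarrow> psi F f \<rho> \<sigma> u y' z \<le> psi F f \<rho> \<sigma> u y z"
    using inner_max_attained[OF assms] by blast
  show ?thesis
    unfolding y(2) using y(1,3) by (blast intro: order_trans)
qed

text \<open>Lower-level optimality of \<open>y\<close> gives the penalty term the favourable sign,
  and the rest is a completed square. The square is kept because it makes \<open>inner_max\<close>
  coercive in \<open>z\<close>.\<close>

lemma psi_lower_sol_ge:
  assumes "y \<in> lower_sol f Y u" "z \<in> Y" "\<rho> > 0"
  shows "psi F f \<rho> \<sigma> u y z \<ge> F (u, y) + \<sigma> / 2 * (norm (z - y))\<^sup>2 - \<sigma> / 2 * (norm y)\<^sup>2"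
proof -
  have "\<rho> * (f (u, y) - f (u, z)) \<le> 0"
    using assms by (auto simp: mem_lower_sol_iff mult_le_0_iff)
  moreover have "\<sigma> / 2 * (norm (z - y))\<^sup>2 - \<sigma> / 2 * (norm y)\<^sup>2 = \<sigma> / 2 * (norm z)\<^sup>2 - \<sigma> * (y \<bullet> z)"
    by (simp add: power2_norm_eq_inner inner_diff_left inner_diff_right inner_commute algebra_simps)
  ultimately show ?thesis
    unfolding psi_def by linarith
qed

lemma phi_reg_attained:
  assumes "u \<in> X" "\<rho> > 0" "\<sigma> > 0"
  obtains z where "z \<in> Y" "phi_reg F f Y \<rho> \<sigma> u = inner_max \<rho> \<sigma> u z"
    "\<And>z'. z' \<in> Y \<Longrightarrow> inner_max \<rho> \<sigma> u z \<le> inner_max \<rho> \<sigma> u z'"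
proof -
  obtain y where y: "y \<in> lower_sol f Y u"
    using lower_sol_nonempty[OF assms(1)] by blast
  then have "y \<in> Y"
    by (simp add: mem_lower_sol_iff)
  have "compact {z \<in> Y. inner_max \<rho> \<sigma> u z \<le> c}" for c
  proof -
    have "{z \<in> Y. inner_max \<rho> \<sigma> u z \<le> c} = Y \<inter> (\<Inter>y\<in>Y. {z. psi F f \<rho> \<sigma> u y z \<le> c})"
      using inner_max_le_iff[OF assms(1,2)] by auto
    then have "closed {z \<in> Y. inner_max \<rho> \<sigma> u z \<le> c}"
      using closed_Y unfolding psi_def
      by (auto intro!: closed_Int closed_INT closed_Collect_le continuous_intros)
    \<comment> \<open>The radius is the quadratic growth bound around the fixed lower-level solution
      \<open>y\<close>, solved for the distance.\<close>
    moreover have "dist y z \<le> sqrt ((c - F (u, y) + \<sigma> / 2 * (norm y)\<^sup>2) / (\<sigma> / 2))"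
      if "z \<in> Y" "inner_max \<rho> \<sigma> u z \<le> c" for z
    proof (rule real_le_rsqrt)
      have "psi F f \<rho> \<sigma> u y z \<le> c"
        using that inner_max_le_iff[OF assms(1,2)] \<open>y \<in> Y\<close> by blast
      then have "\<sigma> / 2 * (norm (z - y))\<^sup>2 \<le> c - F (u, y) + \<sigma> / 2 * (norm y)\<^sup>2"
        using psi_lower_sol_ge[OF y that(1) assms(2), of \<sigma>] by linarith
      then show "(dist y z)\<^sup>2 \<le> (c - F (u, y) + \<sigma> / 2 * (norm y)\<^sup>2) / (\<sigma> / 2)"
        using assms(3) by (simp add: dist_norm norm_minus_commute field_simps)
    qed
    then have "bounded {z \<in> Y. inner_max \<rho> \<sigma> u z \<le> c}"
      unfolding bounded_def by blast
    ultimately show ?thesis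
      by (simp add: compact_eq_bounded_closed)
  qed
  with \<open>y \<in> Y\<close> obtain z where z: "z \<in> Y"
    "\<And>z'. z' \<in> Y \<Longrightarrow> inner_max \<rho> \<sigma> u z \<le> inner_max \<rho> \<sigma> u z'"
    using attains_min_compact_sublevels[of Y "inner_max \<rho> \<sigma> u"] by blast
  have "phi_reg F f Y \<rho> \<sigma> u = (LEAST w. w \<in> inner_max \<rho> \<sigma> u ` Y)"
    unfolding phi_reg_def inner_max_def ..
  then show ?thesis
    using that[OF z(1)] Least_image_eq[of z Y "inner_max \<rho> \<sigma> u", OF z] z(2) by simp
qed

lemma phi_reg_lower:
  assumes "u \<in> X" "\<rho> > 0" "\<sigma> > 0"
    and y: "y \<in> lower_sol f Y u"
  shows "F (u, y) - \<sigma> / 2 * (norm y)\<^sup>2 \<le> phi_reg F f Y \<rho> \<sigma> u"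
proof -
  obtain z where z: "z \<in> Y" "phi_reg F f Y \<rho> \<sigma> u = inner_max \<rho> \<sigma> u z"
    using phi_reg_attained[OF assms(1-3)] by metis
  have "psi F f \<rho> \<sigma> u y z \<le> inner_max \<rho> \<sigma> u z"
    using inner_max_le_iff[OF assms(1,2)] y unfolding mem_lower_sol_iff by blast
  moreover have "0 \<le> \<sigma> / 2 * (norm (z - y))\<^sup>2"
    using assms(3) by simp
  ultimately show ?thesis
    using psi_lower_sol_ge[OF y z(1) assms(2), of \<sigma>] z(2) by linarith
qed

lemma phi_reg_upper:
  assumes "u \<in> X" "\<rho> > 0" "\<sigma> > 0" "z \<in> Y"
    and "\<And>y. y \<in> Y \<Longrightarrow> psi F f \<rho> \<sigma> u y z \<le> c"
  shows "phi_reg F f Y \<rho> \<sigma> u \<le> c"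
proof -
  have "phi_reg F f Y \<rho> \<sigma> u \<le> inner_max \<rho> \<sigma> u z"
    using phi_reg_attained[OF assms(1-3)] assms(4) by metis
  also have "\<dots> \<le> c"
    using inner_max_le_iff[OF assms(1,2)] assms(5) by blast
  finally show ?thesis .
qed

section \<open>Asymptotic upper bound at a fixed point\<close>

text \<open>Otherwise responses \<open>y k\<close> violate the bound along a subsequence. Strong
  concavity keeps them bounded; a limit \<open>y0\<close> is a lower-level solution because the
  penalty blows up, yet \<open>F (u, y0) \<ge> F (u, z) + e\<close> contradicts the choice of
  \<open>z\<close>.\<close>

lemma eventually_psi_le:
  assumes u: "u \<in> X" and \<rho>: "\<And>k. \<rho> k > 0" and \<sigma>: "\<And>k. \<sigma> k > 0"
    and \<rho>_lim: "filterlim \<rho> at_top sequentially" and \<sigma>_lim: "\<sigma> \<longlonglongrightarrow> 0"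
    and z: "z \<in> lower_sol f Y u" and zmax: "\<And>y. y \<in> lower_sol f Y u \<Longrightarrow> F (u, y) \<le> F (u, z)"
    and "e > 0"
  shows "\<forall>\<^sub>F k in sequentially. \<forall>y\<in>Y. psi F f (\<rho> k) (\<sigma> k) u y z \<le> F (u, z) + e"
proof (rule ccontr)
  assume "\<not> ?thesis"
  then have "\<exists>\<^sub>F k in sequentially. \<exists>y\<in>Y. psi F f (\<rho> k) (\<sigma> k) u y z > F (u, z) + e"
    by (simp only: not_eventually ball_simps not_le)
  then have "infinite {k. \<exists>y\<in>Y. psi F f (\<rho> k) (\<sigma> k) u y z > F (u, z) + e}"
    unfolding frequently_cofinite[symmetric] cofinite_eq_sequentially .
  from infinite_enumerate[OF this] obtain r :: "nat \<Rightarrow> nat" where r: "strict_mono r"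
    "\<And>k. \<exists>y\<in>Y. psi F f (\<rho> (r k)) (\<sigma> (r k)) u y z > F (u, z) + e"
    by blast
  then obtain y where y: "\<And>k. y k \<in> Y"
    "\<And>k. psi F f (\<rho> (r k)) (\<sigma> (r k)) u (y k) z > F (u, z) + e"
    by metis
  have zY: "z \<in> Y" and zmin: "\<And>y. y \<in> Y \<Longrightarrow> f (u, z) \<le> f (u, y)"
    using z by (auto simp: mem_lower_sol_iff)
  obtain S where S: "\<And>k. \<sigma> k \<le> S"
    using convergent_imp_Bseq[of \<sigma>] \<sigma>_lim unfolding convergent_def Bseq_def
    by (metis abs_le_D1 real_norm_def)
  have psi_le: "psi F f (\<rho> k) (\<sigma> k) u p z \<le> F (u, p) + \<sigma> k * ((norm z)\<^sup>2 / 2 - p \<bullet> z)"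
    if "p \<in> Y" for k p
    using zmin[OF that] \<rho>[of k] by (simp add: psi_def algebra_simps)
  \<comment> \<open>Bounds the \<sigma>-term for all \<open>p\<close> in the unit ball around
    \<open>z\<close>, where \<open>norm p \<le> norm z + 1\<close>.\<close>
  define B where "B = S * ((norm z)\<^sup>2 / 2 + (norm z + 1) * norm z)"
  have "bdd_above ((\<lambda>p. F (u, p)) ` cball z 1)"
    by (intro bounded_imp_bdd_above compact_imp_bounded compact_continuous_image continuous_intros) auto
  then obtain M where M: "\<And>p. p \<in> cball z 1 \<Longrightarrow> F (u, p) \<le> M"
    unfolding bdd_above_def by blast
  have psi_M: "psi F f (\<rho> k) (\<sigma> k) u p z \<le> M + B" if p: "p \<in> Y" "p \<in> cball z 1" for k p
  proof -
    have "norm p \<le> norm z + 1"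
      using p(2) norm_triangle_ineq2[of p z] by (simp add: dist_norm norm_minus_commute)
    then have "norm p * norm z \<le> (norm z + 1) * norm z"
      by (rule mult_right_mono) simp
    then have "- (p \<bullet> z) \<le> (norm z + 1) * norm z"
      using Cauchy_Schwarz_ineq2[of p z] by linarith
    then have "\<sigma> k * ((norm z)\<^sup>2 / 2 - p \<bullet> z)
        \<le> \<sigma> k * ((norm z)\<^sup>2 / 2 + (norm z + 1) * norm z)"
      using \<sigma>[of k] by (intro mult_left_mono) auto
    also have "\<dots> \<le> B"
      unfolding B_def using S[of k] by (intro mult_right_mono) auto
    finally have "\<sigma> k * ((norm z)\<^sup>2 / 2 - p \<bullet> z) \<le> B" .
    then show ?thesis
      using psi_le[OF p(1), of k] M[OF p(2)] by linarith
  qed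
  have "dist z (y k) \<le> 1 + 2 * (M + B - (F (u, z) - S / 2 * (norm z)\<^sup>2)) / \<mu>" for k
  proof -
    let ?g = "\<lambda>p. psi F f (\<rho> (r k)) (\<sigma> (r k)) u p z"
    \<comment> \<open>On the diagonal the penalty vanishes and \<open>?g z\<close> is at most
      \<open>F (u, z)\<close>, so each violating \<open>y k\<close> lies in the superlevel set of
      \<open>z\<close>.\<close>
    have gz: "?g z = F (u, z) - \<sigma> (r k) / 2 * (norm z)\<^sup>2"
      by (simp add: psi_def power2_norm_eq_inner)
    have "0 \<le> \<sigma> (r k) / 2 * (norm z)\<^sup>2"
      using \<sigma>[of "r k"] by simp
    then have "?g z \<le> ?g (y k)"
      using y(2)[of k] \<open>e > 0\<close> gz by linarith
    then have "norm (y k - z) \<le> 1 + 2 * (M + B - ?g z) / \<mu>"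
      using strongly_concave_on_superlevel_bound[OF strongly_concave_psi[OF u \<rho>] \<mu>_pos y(1) zY]
        psi_M by blast
    \<comment> \<open>Replacing \<sigma> by its bound \<open>S\<close> makes the radius independent
      of \<open>k\<close>.\<close>
    moreover have "F (u, z) - S / 2 * (norm z)\<^sup>2 \<le> ?g z"
      unfolding gz using S[of "r k"] by (simp add: mult_right_mono)
    then have "2 * (M + B - ?g z) / \<mu> \<le> 2 * (M + B - (F (u, z) - S / 2 * (norm z)\<^sup>2)) / \<mu>"
      using \<mu>_pos by (intro divide_right_mono mult_left_mono) auto
    ultimately show ?thesis
      unfolding dist_norm norm_minus_commute[of z] by linarith
  qed
  then have "bounded (range y)"
    unfolding bounded_def by blast
  then obtain y0 s where s: "strict_mono s" and ys: "(y \<circ> s) \<longlonglongrightarrow> y0"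
    using bounded_imp_convergent_subsequence by metis
  define q where "q = r \<circ> s"
  have q: "strict_mono q"
    unfolding q_def using r(1) s by (rule strict_mono_o)
  have \<sigma>q: "(\<lambda>k. \<sigma> (q k)) \<longlonglongrightarrow> 0"
    using LIMSEQ_subseq_LIMSEQ[OF \<sigma>_lim q] by (simp add: o_def)
  have \<rho>q: "filterlim (\<lambda>k. \<rho> (q k)) at_top sequentially"
    using filterlim_compose[OF \<rho>_lim filterlim_subseq[OF q]] .
  have y0: "(\<lambda>k. y (s k)) \<longlonglongrightarrow> y0" "y0 \<in> Y"
    using ys y(1) closed_sequentially[OF closed_Y, of "y \<circ> s" y0] by (auto simp: o_def)
  have gt: "F (u, z) + e < psi F f (\<rho> (q k)) (\<sigma> (q k)) u (y (s k)) z" for k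
    using y(2)[of "s k"] by (simp add: q_def)
  have Flim: "(\<lambda>k. F (u, y (s k))) \<longlonglongrightarrow> F (u, y0)"
    by (rule continuous_on_tendsto_compose[OF _ y0(1), of UNIV]) (auto intro!: continuous_intros)
  have flim: "(\<lambda>k. f (u, y (s k))) \<longlonglongrightarrow> f (u, y0)"
    by (rule continuous_on_tendsto_compose[OF _ y0(1), of UNIV]) (auto intro!: continuous_intros)
  \<comment> \<open>\<open>h k\<close> is \<open>psi\<close> without its penalty; the \<sigma>-term
    dies out since \<open>y (s k)\<close> converges.\<close>
  define h where "h k = F (u, y (s k)) + \<sigma> (q k) * ((norm z)\<^sup>2 / 2 - y (s k) \<bullet> z)" for k
  have hlim: "h \<longlonglongrightarrow> F (u, y0)"
    using tendsto_add[OF Flim tendsto_mult[OF \<sigma>q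
          tendsto_diff[OF tendsto_const tendsto_inner[OF y0(1) tendsto_const]]]]
    unfolding h_def by simp
  have "F (u, z) + e \<le> h k" for k
    unfolding h_def using gt[of k] psi_le[OF y(1), of "q k" "s k"] by linarith
  then have "F (u, z) + e \<le> F (u, y0)"
    using hlim by (intro LIMSEQ_le_const) auto
  moreover have "y0 \<in> lower_sol f Y u"
  proof -
    \<comment> \<open>Here the penalty is retained: \<rho> times the gap in \<open>f\<close> equals
      \<open>h k\<close> minus \<open>psi\<close>. As \<open>h\<close> converges, division by \<rho>
      forces the gap to vanish in the limit.\<close>
    have "f (u, y (s k)) - f (u, z) \<le> (h k - F (u, z)) / \<rho> (q k)" for k
      using gt[of k] \<rho>[of "q k"] \<open>e > 0\<close> by (simp add: psi_def h_def field_simps)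
    moreover have "(\<lambda>k. (h k - F (u, z)) / \<rho> (q k)) \<longlonglongrightarrow> 0"
      by (intro real_tendsto_divide_at_top[of _ "F (u, y0) - F (u, z)"] tendsto_intros hlim \<rho>q)
    ultimately have "f (u, y0) - f (u, z) \<le> 0"
      using flim by (intro LIMSEQ_le[of "\<lambda>k. f (u, y (s k)) - f (u, z)"]) (auto intro!: tendsto_intros)
    then show ?thesis
      using y0(2) zmin unfolding mem_lower_sol_iff by force
  qed
  ultimately show False
    using zmax \<open>e > 0\<close> by fastforce
qed

section \<open>Uniform bound on pessimistic responses\<close>

text \<open>\<open>D\<close> supplies one bounded lower-level solution \<open>d\<close> for each
  \<open>u\<close>, while a maximiser \<open>y\<close> may lie elsewhere. Since
  \<open>F (u, d) \<le> F (u, y)\<close>, strong concavity confines \<open>y\<close> to a ball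
  around \<open>d\<close> with radius independent of \<open>u\<close>.\<close>

lemma pess_maximizers_bounded:
  assumes bd: "bounded B" and BX: "B \<subseteq> X" and D: "bounded D"
    and SD: "\<And>u. u \<in> B \<Longrightarrow> lower_sol f Y u \<inter> D \<noteq> {}"
  obtains R where "\<And>u y. u \<in> B \<Longrightarrow> y \<in> lower_sol f Y u \<Longrightarrow>
    (\<And>y'. y' \<in> lower_sol f Y u \<Longrightarrow> F (u, y') \<le> F (u, y)) \<Longrightarrow> norm y \<le> R"
proof -
  obtain N where N: "\<And>d. d \<in> D \<Longrightarrow> norm d \<le> N"
    using D unfolding bounded_iff by blast
  \<comment> \<open>Radius \<open>N + 1\<close> covers the unit balls around all such
    \<open>d\<close>; the closure of \<open>B\<close> provides compactness.\<close>
  have "bounded (F ` (closure B \<times> cball 0 (N + 1)))"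
    using bd by (intro compact_imp_bounded compact_continuous_image
        continuous_on_subset[OF continuous_F] compact_Times) (auto simp: compact_closure)
  then obtain M where M: "\<And>u y. u \<in> B \<Longrightarrow> norm y \<le> N + 1 \<Longrightarrow> \<bar>F (u, y)\<bar> \<le> M"
    unfolding bounded_iff using closure_subset[of B] by (fastforce simp: dist_norm)
  have "norm y \<le> N + (1 + 4 * M / \<mu>)"
    if u: "u \<in> B" and y: "y \<in> lower_sol f Y u"
      and ymax: "\<And>y'. y' \<in> lower_sol f Y u \<Longrightarrow> F (u, y') \<le> F (u, y)" for u y
  proof -
    obtain d where d: "d \<in> lower_sol f Y u" "norm d \<le> N"
      using SD[OF u] N by blast
    have "F (u, p) \<le> M" if "p \<in> cball d 1" for p
    proof -
      have "norm p \<le> norm d + norm (p - d)"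
        by (rule norm_triangle_sub)
      then have "norm p \<le> N + 1"
        using that d(2) by (simp add: dist_norm norm_minus_commute)
      then show ?thesis
        using M[OF u] by fastforce
    qed
    then have "norm (y - d) \<le> 1 + 2 * (M - F (u, d)) / \<mu>"
      using strongly_concave_on_superlevel_bound[OF strongly_concave_F \<mu>_pos, of u y d M]
        u BX y d ymax by (auto simp: mem_lower_sol_iff)
    \<comment> \<open>\<open>\<bar>F (u, d)\<bar> \<le> M\<close> gives
      \<open>M - F (u, d) \<le> 2 * M\<close>.\<close>
    also have "\<dots> \<le> 1 + 4 * M / \<mu>"
      using M[OF u, of d] d(2) \<mu>_pos by (auto simp: abs_le_iff intro!: divide_right_mono)
    finally show ?thesis
      using d(2) norm_triangle_sub[of y d] by linarith
  qed
  then show ?thesis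
    using that by blast
qed

end

section \<open>Accumulation points of the minimisers\<close>

theorem theorem2p5:
  fixes X :: "(real ^ 'n) set"
    and Y :: "(real ^ 'm) set"
    and F f :: "(real ^ 'n) \<times> (real ^ 'm) \<Rightarrow> real"
    and \<mu> :: real
    and \<rho> \<sigma> :: "nat \<Rightarrow> real"
    and x :: "nat \<Rightarrow> real ^ 'n"
    and xbar :: "real ^ 'n"
  assumes "closed X" and "convex X"
    and "closed Y" and "convex Y"
    and "C1_lipschitz_gradient_on (X \<times> Y) F"
    and "\<mu> > 0"
    and "\<And>u. u \<in> X \<Longrightarrow> strongly_concave_on \<mu> Y (\<lambda>y. F (u, y))"
    and "C1_lipschitz_gradient_on (X \<times> Y) f"
    and "\<And>u. u \<in> X \<Longrightarrow> convex_on Y (\<lambda>y. f (u, y))"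
    and "\<And>u. u \<in> X \<Longrightarrow> lower_sol f Y u \<noteq> {}"
    and "\<And>B. B \<subseteq> X \<Longrightarrow> bounded B \<Longrightarrow>
           \<exists>D. bounded D \<and> (\<forall>u\<in>B. lower_sol f Y u \<inter> D \<noteq> {})"
    and "lsc_on X (pess_value F f Y)"
    and "\<And>k. \<rho> k > 0" and "\<And>k. \<sigma> k > 0"
    and "filterlim \<rho> at_top sequentially" and "\<sigma> \<longlonglongrightarrow> 0"
    and "\<And>k. x k \<in> argmin_set (phi_reg F f Y (\<rho> k) (\<sigma> k)) X"
    and "accumulation_point x xbar"
  shows "xbar \<in> argmin_set (pess_value F f Y) X"
proof -
  interpret lower_level X Y F f \<mu>
    using assms by unfold_locales (auto intro: C1_lipschitz_gradient_on_imp_continuous)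
  obtain r where r: "strict_mono r" and xr: "(x \<circ> r) \<longlonglongrightarrow> xbar"
    using assms(18) unfolding accumulation_point_def by blast
  have x_min: "x k \<in> X" "\<And>u. u \<in> X \<Longrightarrow>
      phi_reg F f Y (\<rho> k) (\<sigma> k) (x k) \<le> phi_reg F f Y (\<rho> k) (\<sigma> k) u" for k
    using assms(17)[of k] by (auto simp: mem_argmin_set_iff)
  have xbar: "xbar \<in> X"
    using closed_sequentially[OF assms(1) _ xr] x_min(1) by simp
  have B: "bounded (range (x \<circ> r))" "range (x \<circ> r) \<subseteq> X"
    using convergent_imp_bounded[OF xr] x_min(1) by auto
  then obtain R where R: "\<And>u y. u \<in> range (x \<circ> r) \<Longrightarrow> y \<in> lower_sol f Y u \<Longrightarrow>
      (\<And>y'. y' \<in> lower_sol f Y u \<Longrightarrow> F (u, y') \<le> F (u, y)) \<Longrightarrow> norm y \<le> R"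
    using assms(11)[of "range (x \<circ> r)"] pess_maximizers_bounded[of "range (x \<circ> r)"] by metis
  \<comment> \<open>\<open>R\<close> is the same for all \<open>k\<close>, so the error vanishes
    with \<sigma>.\<close>
  have lower: "pess_value F f Y (x (r k))
      \<le> phi_reg F f Y (\<rho> (r k)) (\<sigma> (r k)) (x (r k)) + \<sigma> (r k) / 2 * R\<^sup>2" for k
  proof -
    obtain y where y: "y \<in> lower_sol f Y (x (r k))" "pess_value F f Y (x (r k)) = F (x (r k), y)"
      "\<And>y'. y' \<in> lower_sol f Y (x (r k)) \<Longrightarrow> F (x (r k), y') \<le> F (x (r k), y)"
      using pess_value_attained[OF x_min(1)] by metis
    have "norm y \<le> R"
      using R[of "x (r k)" y] y by auto
    then have "\<sigma> (r k) / 2 * (norm y)\<^sup>2 \<le> \<sigma> (r k) / 2 * R\<^sup>2"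
      using assms(14)[of "r k"] by (intro mult_left_mono power_mono) auto
    then show ?thesis
      using phi_reg_lower[OF x_min(1) assms(13,14) y(1), of "r k" "r k"] y(2) by linarith
  qed
  have "pess_value F f Y xbar \<le> pess_value F f Y u" if u: "u \<in> X" for u
  proof (rule field_le_epsilon)
    fix e :: real
    assume "e > 0"
    obtain z where z: "z \<in> lower_sol f Y u" "pess_value F f Y u = F (u, z)"
      "\<And>y. y \<in> lower_sol f Y u \<Longrightarrow> F (u, y) \<le> F (u, z)"
      using pess_value_attained[OF u] by metis
    then have zY: "z \<in> Y"
      by (simp add: mem_lower_sol_iff)
    \<comment> \<open>Half of \<open>e\<close> pays for the response \<open>z\<close> at
      \<open>u\<close>, the other half for the error term in \<open>lower\<close>.\<close>
    have "\<forall>\<^sub>F k in sequentially. \<forall>y\<in>Y. psi F f (\<rho> k) (\<sigma> k) u y z \<le> F (u, z) + e / 2"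
      using \<open>e > 0\<close> by (intro eventually_psi_le assms u z) auto
    then have "\<forall>\<^sub>F k in sequentially. \<forall>y\<in>Y. psi F f (\<rho> (r k)) (\<sigma> (r k)) u y z \<le> F (u, z) + e / 2"
      by (rule eventually_subseq[OF r])
    moreover have "(\<lambda>k. \<sigma> (r k) / 2 * R\<^sup>2) \<longlonglongrightarrow> 0 / 2 * R\<^sup>2"
      using LIMSEQ_subseq_LIMSEQ[OF assms(16) r] by (intro tendsto_intros) (auto simp: o_def)
    then have "\<forall>\<^sub>F k in sequentially. \<sigma> (r k) / 2 * R\<^sup>2 < e / 2"
      using \<open>e > 0\<close> order_tendstoD(2) by fastforce
    ultimately have "\<forall>\<^sub>F k in sequentially.
        ereal (pess_value F f Y ((x \<circ> r) k)) \<le> ereal (pess_value F f Y u + e)"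
    proof eventually_elim
      case (elim k)
      \<comment> \<open>The chain runs from the pessimistic value at \<open>x (r k)\<close> via
        \<open>lower\<close> to \<open>phi_reg\<close> there, by minimality to
        \<open>phi_reg\<close> at \<open>u\<close>, and then to \<open>F (u, z)\<close>.\<close>
      have "phi_reg F f Y (\<rho> (r k)) (\<sigma> (r k)) u \<le> F (u, z) + e / 2"
        using phi_reg_upper[OF u assms(13,14) zY] elim(1) by blast
      then show ?case
        using lower[of k] x_min(2)[OF u, of "r k"] elim(2) z(2) by simp
    qed
    then have "liminf (\<lambda>k. ereal (pess_value F f Y ((x \<circ> r) k))) \<le> ereal (pess_value F f Y u + e)"
      by (intro Liminf_le) auto
    moreover have "ereal (pess_value F f Y xbar)
        \<le> liminf (\<lambda>k. ereal (pess_value F f Y ((x \<circ> r) k)))"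
      using assms(12)[unfolded lsc_on_def, rule_format, of "x \<circ> r" xbar] xr xbar x_min(1) by simp
    ultimately show "pess_value F f Y xbar \<le> pess_value F f Y u + e"
      using order_trans by fastforce
  qed
  with xbar show ?thesis
    by (simp add: mem_argmin_set_iff)
qed

end
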